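(* Let $\Omega$ be a complete ultrametric valued field with norm $|\cdot|$, let $q\in\Omega$ with $|q|>1$, and let $$F(x,w_0,\dots,w_n)=\sum_{k,k_0,\dots,k_n\ge 0}A_{k,k_0,\dots,k_n}x^kw_0^{k_0}\cdots w_n^{k_n}\in\Omega[[x,w_0,\dots,w_n]]$$ be a power series with $F(0,\dots,0)=0$ which is analytic at $0$, i.e. $$\limsup_{k+\sum_i k_i\to\infty}|A_{k,k_0,\dots,k_n}|^{\frac{1}{k+\sum_i k_i}}<+\infty.$$ Let $\varphi(x)\in x\Omega[[x]]$ be a formal solution of the equation $$F(x,\varphi(x),\varphi(qx),\dots,\varphi(q^nx))=0.$$ If $F(x,w_0,\dots,w_n)$ is not identically zero, then there exists $s\in\mathbb{R}$ such that $\varphi(x)$ is a $q$-Gevrey series of order $s$.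
   Context: For $\varphi(x)=\sum_h\varphi_hx^h\in\Omega[[x]]$, $\varphi(q^ix)=\sum_h q^{ih}\varphi_hx^h$. $q$-Gevrey series: $\varphi(x)=\sum_{h\ge 0}\varphi_hx^h\in\Omega[[x]]$ is a $q$-Gevrey series of order $s\in\mathbb{R}$ if the series $\sum_{h\ge 0}\frac{\varphi_h}{q^{s h(h-1)/2}}x^h$ is convergent (has positive radius of convergence), i.e. $\limsup_{h\to\infty}\left(|\varphi_h|\,|q|^{-s h(h-1)/2}\right)^{1/h}<+\infty$. *)

theory Defs
  imports "HOL-Analysis.Analysis" "HOL-Computational_Algebra.Formal_Power_Series"
begin

(* The norm is an explicit parameter: the library class real_normed_field would force an
   archimedean norm. *)
locale ultrametric_valued_field =
  fixes nrm :: "'a::field \<Rightarrow> real"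
  assumes nrm_nonneg: "0 \<le> nrm x"
    and nrm_eq_0_iff: "nrm x = 0 \<longleftrightarrow> x = 0"
    and nrm_mult: "nrm (x * y) = nrm x * nrm y"
    and nrm_add_le_max: "nrm (x + y) \<le> max (nrm x) (nrm y)"

locale complete_ultrametric_valued_field = ultrametric_valued_field +
  assumes complete: "Metric_space.mcomplete UNIV (\<lambda>x y. nrm (x - y))"

lemma (in ultrametric_valued_field) Metric_space_nrm:
  "Metric_space UNIV (\<lambda>x y. nrm (x - y))"
proof -
  have n1: "nrm 1 = 1"
    using nrm_mult[of 1 1] nrm_eq_0_iff[of 1] by simp
  have "nrm (-1) * nrm (-1) = 1"
    using nrm_mult[of "-1" "-1"] n1 by simp
  then have "nrm (-1) = 1"
    using nrm_nonneg[of "-1"] by (auto simp: square_eq_1_iff)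
  then have neg: "nrm (- x) = nrm x" for x
    using nrm_mult[of "-1" x] by simp
  have tri: "nrm (x - z) \<le> nrm (x - y) + nrm (y - z)" for x y z
    using nrm_add_le_max[of "x - y" "y - z"] nrm_nonneg[of "x - y"] nrm_nonneg[of "y - z"]
    by simp
  show ?thesis
  proof
    show "nrm (x - y) = nrm (y - x)" for x y
      using neg[of "x - y"] by simp
  qed (use nrm_nonneg nrm_eq_0_iff tri in auto)
qed

(* A power series F in x, w_0, ..., w_n is the family of its coefficients: F (k, [k_0, ..., k_n])
   is the coefficient of x^k w_0^k_0 ... w_n^k_n.  Values of F outside mexps n are irrelevant. *)
definition mexps :: "nat \<Rightarrow> (nat \<times> nat list) set" where
  "mexps n = {(k, ks). length ks = Suc n}"

definition mdeg :: "nat \<times> nat list \<Rightarrow> nat" where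
  "mdeg e = fst e + sum_list (snd e)"

definition analytic_at_0 :: "('a::field \<Rightarrow> real) \<Rightarrow> nat \<Rightarrow> (nat \<times> nat list \<Rightarrow> 'a) \<Rightarrow> bool" where
  "analytic_at_0 nrm n F \<longleftrightarrow>
     Limsup (inf (filtercomap mdeg at_top) (principal (mexps n)))
       (\<lambda>e. ereal (root (mdeg e) (nrm (F e)))) < \<infinity>"

(* fps_dilate c f is f(c x). *)
definition fps_dilate :: "'a::field \<Rightarrow> 'a fps \<Rightarrow> 'a fps" where
  "fps_dilate c f = Abs_fps (\<lambda>h. c ^ h * fps_nth f h)"

definition mterm ::
  "nat \<Rightarrow> (nat \<times> nat list \<Rightarrow> 'a::field) \<Rightarrow> (nat \<Rightarrow> 'a fps) \<Rightarrow> nat \<times> nat list \<Rightarrow> 'a fps" where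
  "mterm n F g = (\<lambda>(k, ks). fps_const (F (k, ks)) * fps_X ^ k * (\<Prod>i\<le>n. g i ^ (ks ! i)))"

(* F(x, g_0(x), ..., g_n(x)) for g_i without constant term: then a monomial of total degree
   greater than m does not contribute to the coefficient of x^m.  The lemma has_sum_msubst
   identifies this with the sum of the full series in the x-adic topology. *)
definition msubst :: "nat \<Rightarrow> (nat \<times> nat list \<Rightarrow> 'a::field) \<Rightarrow> (nat \<Rightarrow> 'a fps) \<Rightarrow> 'a fps" where
  "msubst n F g =
     Abs_fps (\<lambda>m. \<Sum>e\<in>{e \<in> mexps n. mdeg e \<le> m}. fps_nth (mterm n F g e) m)"

lemma finite_mexps_le: "finite {e \<in> mexps n. mdeg e \<le> m}"
proof -
  have "{e \<in> mexps n. mdeg e \<le> m} \<subseteq> {..m} \<times> {ks. set ks \<subseteq> {..m} \<and> length ks = Suc n}"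
    unfolding mexps_def mdeg_def
    by (auto dest: member_le_sum_list)
  then show ?thesis
    by (rule finite_subset) (intro finite_cartesian_product finite_lists_length_eq; simp)
qed

lemma dvd_mterm:
  assumes "\<And>i. i \<le> n \<Longrightarrow> fps_nth (g i) 0 = 0" "e \<in> mexps n"
  shows "fps_X ^ mdeg e dvd mterm n F g e"
proof -
  obtain k ks where e: "e = (k, ks)" "length ks = Suc n"
    using assms(2) by (auto simp: mexps_def)
  have X: "fps_X dvd g i" if "i \<le> n" for i
    proof -
    have "g i = fps_shift 1 (g i) * fps_X"
      using assms(1)[OF that] by (auto simp: fps_eq_iff)
    then show ?thesis by (metis dvd_triv_right)
  qed
  have "sum_list ks = (\<Sum>i\<le>n. ks ! i)"
    by (simp add: sum_list_sum_nth e(2) atLeast0LessThan lessThan_Suc_atMost)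
  then have "fps_X ^ sum_list ks = (\<Prod>i\<le>n. (fps_X :: 'a fps) ^ (ks ! i))"
    by (simp add: power_sum)
  also have "\<dots> dvd (\<Prod>i\<le>n. g i ^ (ks ! i))"
    by (rule prod_dvd_prod) (use X in \<open>auto intro: dvd_power_same\<close>)
  finally show ?thesis
    by (auto simp: e mdeg_def mterm_def power_add intro: mult_dvd_mono)
qed

lemma has_sum_msubst:
  assumes "\<And>i. i \<le> n \<Longrightarrow> fps_nth (g i) 0 = 0"
  shows "(mterm n F g has_sum msubst n F g) (mexps n)"
  unfolding has_sum_def
proof (rule tendsto_fpsI)
  fix m
  let ?S = "{e \<in> mexps n. mdeg e \<le> m}"
  have z: "fps_nth (mterm n F g e) m = 0" if e: "e \<in> mexps n" "e \<notin> ?S" for e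
  proof -
    obtain h where "mterm n F g e = fps_X ^ mdeg e * h"
      using dvd_mterm[of n g e F] assms e(1) by (auto elim: dvdE)
    then show ?thesis using e by (simp add: fps_X_power_mult_nth)
  qed
  have "fps_nth (sum (mterm n F g) T) m = fps_nth (msubst n F g) m"
    if "finite T" "?S \<subseteq> T" "T \<subseteq> mexps n" for T
    unfolding msubst_def fps_sum_nth
    by (simp, rule sum.mono_neutral_right) (use that z in auto)
  then show "eventually (\<lambda>T. fps_nth (sum (mterm n F g) T) m = fps_nth (msubst n F g) m)
      (finite_subsets_at_top (mexps n))"
    unfolding eventually_finite_subsets_at_top
    by (intro exI[of _ ?S]) (auto simp: finite_mexps_le)
qed

definition q_gevrey :: "('a::field \<Rightarrow> real) \<Rightarrow> 'a \<Rightarrow> real \<Rightarrow> 'a fps \<Rightarrow> bool" where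
  "q_gevrey nrm q s \<phi> \<longleftrightarrow>
     limsup (\<lambda>h. ereal (root h (nrm (fps_nth \<phi> h) * nrm q powr (- s * (real h * (real h - 1) / 2))))) < \<infinity>"

end

theory Submission
  imports Defs
begin

text \<open>Write \<open>\<Phi>\<close> for the tuple of the series \<open>\<phi>(q\<^sup>i x)\<close> and expand \<open>F(x, \<Phi> + y)\<close> in powers of \<open>y\<close>; its
  coefficients are the divided derivatives of \<open>F\<close> at \<open>\<Phi>\<close>, and not all of them vanish.  Among all
  analytic \<open>G\<close> with \<open>G(x, \<Phi>) = 0\<close> and a nonzero expansion at \<open>\<Phi>\<close>, take one whose leading form in
  \<open>y\<close> has least degree \<open>m\<close>.  This form is a combination of the pure powers \<open>y\<^sub>j\<^sup>m\<close>: a mixed monomial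
  would survive, with smaller degree, in a divided derivative of \<open>G\<close> in one of its variables.

  Let \<open>v\<close> be the least order of the coefficients of this form.  Replacing \<open>\<phi>\<close> by its truncation
  below \<open>x\<^sup>N\<close> with \<open>N > v\<close> and reading off the coefficient of \<open>x\<close> to the power \<open>v + N m\<close> gives
  \<open>(- \<phi>\<^sub>N)\<^sup>m L(q\<^sup>N)\<close> with a nonzero polynomial \<open>L\<close>, because \<open>y\<^sub>j\<^sup>m\<close> contributes the power of \<open>q\<^sup>N\<close> with
  exponent \<open>j m\<close>, and these are distinct.  So \<open>|L(q\<^sup>N)|\<close> is bounded below for large \<open>N\<close>, while the
  same coefficient is a polynomial in \<open>\<phi>\<^sub>1, \<dots>, \<phi>\<^bsub>N-1\<^esub>\<close> whose monomials have total index at most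
  \<open>v + N m\<close>.  A convexity estimate for the sum of the squared indices then propagates a bound
  \<open>|\<phi>\<^sub>h| \<le> |q|\<^bsup>\<sigma> h h\<^esup>\<close> by induction.  Divided derivatives make the argument
  independent of the characteristic.\<close>

section \<open>Divided derivatives and Taylor expansion\<close>

text \<open>Indexed by the list and not by \<open>n\<close>, so that inductions can split off the
  first variable; on \<open>mexps n\<close> it is the product occurring in
  \<open>mterm\<close>.\<close>

definition mpow :: "(nat \<Rightarrow> 'a::comm_semiring_1) \<Rightarrow> nat list \<Rightarrow> 'a" where
  "mpow g ks = (\<Prod>i<length ks. g i ^ (ks ! i))"

lemma mpow_Nil [simp]: "mpow g [] = 1"
  by (simp add: mpow_def)

lemma mpow_Cons [simp]: "mpow g (k # ks) = g 0 ^ k * mpow (\<lambda>i. g (Suc i)) ks"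
  by (simp add: mpow_def prod.lessThan_Suc_shift del: prod.lessThan_Suc)

definition mbinom :: "nat list \<Rightarrow> nat list \<Rightarrow> nat" where
  "mbinom ks a = (\<Prod>i<length ks. (ks ! i) choose (a ! i))"

lemma mbinom_Nil [simp]: "mbinom [] a = 1"
  by (simp add: mbinom_def)

lemma mbinom_Cons [simp]: "mbinom (k # ks) (x # a) = (k choose x) * mbinom ks a"
  by (simp add: mbinom_def prod.lessThan_Suc_shift del: prod.lessThan_Suc)

lemma lists_le_Cons:
  "{a. list_all2 (\<le>) a (k # ks)} = (\<lambda>(x, a). x # a) ` ({..k} \<times> {a. list_all2 (\<le>) a ks})"
  by (auto simp: list_all2_Cons2)

lemma finite_lists_le: "finite {a. list_all2 (\<le>) a (ks :: nat list)}"
  by (induction ks) (simp_all add: lists_le_Cons del: list_all2_Cons2)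

text \<open>The binomial theorem for each variable, multiplied out by splitting off the first
  one.\<close>

lemma mpow_binomial:
  fixes g y :: "nat \<Rightarrow> 'a::comm_ring_1"
  shows "mpow (\<lambda>i. g i + y i) ks =
    (\<Sum>a | list_all2 (\<le>) a ks. of_nat (mbinom ks a) * mpow g (map2 (-) ks a) * mpow y a)"
proof (induction ks arbitrary: g y)
  case Nil
  then show ?case by simp
next
  case (Cons k ks)
  have inj: "inj_on (\<lambda>(x, a). x # a) ({..k} \<times> {a. list_all2 (\<le>) a ks})"
    by (auto simp: inj_on_def)
  have "mpow (\<lambda>i. g i + y i) (k # ks) =
     (\<Sum>x\<le>k. of_nat (k choose x) * y 0 ^ x * g 0 ^ (k - x)) * 
     (\<Sum>a | list_all2 (\<le>) a ks. of_nat (mbinom ks a) * mpow (\<lambda>i. g (Suc i)) (map2 (-) ks a)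
        * mpow (\<lambda>i. y (Suc i)) a)"
    by (simp add: Cons.IH add.commute[of "g 0"] binomial_ring)
  then show ?case
    unfolding lists_le_Cons sum.reindex[OF inj] 
    by (simp add: sum_product sum.cartesian_product case_prod_beta' algebra_simps)
qed

(* The coefficients of the divided derivative (1 / a!) (d/dw)^a F, which makes sense in positive
   characteristic as well. *)
definition hasse :: "nat list \<Rightarrow> (nat \<times> nat list \<Rightarrow> 'a::field) \<Rightarrow> nat \<times> nat list \<Rightarrow> 'a" where
  "hasse a F = (\<lambda>(k, ks). of_nat (mbinom (map2 (+) ks a) a) * F (k, map2 (+) ks a))"

lemma mterm_eq: "length ks = Suc n \<Longrightarrow>
    mterm n F g (k, ks) = fps_const (F (k, ks)) * fps_X ^ k * mpow g ks"
  by (simp add: mterm_def mpow_def lessThan_Suc_atMost)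

section \<open>Orders of vanishing and arithmetic of exponent lists\<close>

lemma fps_X_power_dvd_nth:
  assumes "fps_X ^ d dvd (f :: 'a::field fps)" "m < d"
  shows "fps_nth f m = 0"
  using assms by (auto elim!: dvdE simp: fps_X_power_mult_nth)

lemma fps_X_power_dvdI:
  assumes "\<And>m. m < d \<Longrightarrow> fps_nth (f :: 'a::field fps) m = 0"
  shows "fps_X ^ d dvd f"
proof -
  have "f = fps_shift d f * fps_X ^ d"
    using assms by (auto simp: fps_eq_iff fps_X_power_mult_right_nth)
  then show ?thesis by (metis dvd_triv_right)
qed

lemma mpow_dvd:
  assumes "\<And>i. i < length a \<Longrightarrow> fps_X ^ d dvd (y i :: 'a::field fps)"
  shows "fps_X ^ (d * sum_list a) dvd mpow y a"
proof -
  have "fps_X ^ (d * sum_list a) = (\<Prod>i<length a. (fps_X ^ d :: 'a fps) ^ (a ! i))"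
    by (simp add: sum_list_sum_nth atLeast0LessThan power_mult power_sum)
  also have "\<dots> dvd mpow y a"
    unfolding mpow_def by (rule prod_dvd_prod) (use assms in \<open>auto intro: dvd_power_same\<close>)
  finally show ?thesis .
qed

lemma sum_list_map2_plus:
  "length ks = length a \<Longrightarrow> sum_list (map2 (+) ks a) = sum_list ks + (sum_list a :: nat)"
  by (induction ks a rule: list_induct2) auto

lemma map2_minus_plus: "list_all2 (\<le>) a ks \<Longrightarrow> map2 (+) (map2 (-) ks a) a = (ks :: nat list)"
  by (induction rule: list_all2_induct) auto

lemma map2_plus_minus: "length ks = length a \<Longrightarrow> map2 (-) (map2 (+) ks a) a = (ks :: nat list)"
  by (induction ks a rule: list_induct2) auto

lemma list_all2_le_map2_plus: "length ks = length a \<Longrightarrow> list_all2 (\<le>) a (map2 (+) ks a :: nat list)"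
  by (induction ks a rule: list_induct2) auto

text \<open>A monomial of degree above \<open>M\<close> has order above \<open>M\<close>. One finite
  set of exponents therefore serves all coefficients up to \<open>M\<close>, and the convolution can
  be exchanged with the sum over exponents.\<close>

lemma fps_nth_msubst_mult:
  assumes "\<And>i. i \<le> n \<Longrightarrow> fps_nth (g i) 0 = 0"
  shows "fps_nth (msubst n F g * f) M =
    (\<Sum>e | e \<in> mexps n \<and> mdeg e \<le> M. fps_nth (mterm n F g e * f) M)"
proof -
  have "fps_nth (msubst n F g) i = (\<Sum>e | e \<in> mexps n \<and> mdeg e \<le> M. fps_nth (mterm n F g e) i)"
    if "i \<le> M" for i
    unfolding msubst_def fps_nth_Abs_fps
  proof (rule sum.mono_neutral_left)
    show "\<forall>e\<in>{e \<in> mexps n. mdeg e \<le> M} - {e \<in> mexps n. mdeg e \<le> i}. fps_nth (mterm n F g e) i = 0"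
      by (auto intro!: fps_X_power_dvd_nth[OF dvd_mterm[OF assms]])
  qed (use that in \<open>auto simp: finite_mexps_le\<close>)
  then have "fps_nth (msubst n F g * f) M =
      (\<Sum>i=0..M. \<Sum>e | e \<in> mexps n \<and> mdeg e \<le> M. fps_nth (mterm n F g e) i * fps_nth f (M - i))"
    unfolding fps_mult_nth by (intro sum.cong) (auto simp: sum_distrib_right)
  then show ?thesis
    by (subst (asm) sum.swap) (simp add: fps_mult_nth)
qed

definition mindices :: "nat \<Rightarrow> nat \<Rightarrow> nat list set" where
  "mindices n M = {a. length a = Suc n \<and> sum_list a \<le> M}"

lemma finite_mindices: "finite (mindices n M)"
proof -
  have "mindices n M \<subseteq> {a. set a \<subseteq> {..M} \<and> length a = Suc n}"
    unfolding mindices_def by (auto dest: member_le_sum_list)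
  then show ?thesis
    by (rule finite_subset) (intro finite_lists_length_eq; simp)
qed

text \<open>Each monomial is expanded by \<open>mpow_binomial\<close>, and the terms are regrouped
  by the exponent \<open>a\<close> of \<open>y\<close>. Since \<open>g\<close> and \<open>y\<close>
  have no constant terms, only finitely many terms reach the coefficient of x^M.\<close>

lemma msubst_taylor:
  assumes g: "\<And>i. i \<le> n \<Longrightarrow> fps_nth (g i) 0 = 0" and y: "\<And>i. i \<le> n \<Longrightarrow> fps_nth (y i) 0 = 0"
  shows "fps_nth (msubst n F (\<lambda>i. g i + y i)) M =
    (\<Sum>a\<in>mindices n M. fps_nth (msubst n (hasse a F) g * mpow y a) M)"
proof -
  let ?E = "{e. e \<in> mexps n \<and> mdeg e \<le> M}"
  let ?t = "\<lambda>a e. fps_nth (mterm n (hasse a F) g e * mpow y a) M"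
  let ?S = "SIGMA e:?E. {a. list_all2 (\<le>) a (snd e)}"
  let ?j = "\<lambda>(e, a). (a, (fst e, map2 (-) (snd e) a))"
  let ?i = "\<lambda>(a, e). ((fst e, map2 (+) (snd e) a), a)"
  let ?T = "{(a, e) \<in> mindices n M \<times> ?E. mdeg e + sum_list a \<le> M}"
  have mono: "mterm n F (\<lambda>i. g i + y i) e =
      (\<Sum>a | list_all2 (\<le>) a (snd e). mterm n (hasse a F) g (fst e, map2 (-) (snd e) a) * mpow y a)"
    if "e \<in> mexps n" for e
  proof -
    obtain k ks where e: "e = (k, ks)" and l: "length ks = Suc n"
      using \<open>e \<in> mexps n\<close> by (auto simp: mexps_def)
    show ?thesis
      unfolding e mterm_eq[OF l] mpow_binomial sum_distrib_left
      by (intro sum.cong refl)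
        (auto simp: mterm_eq l hasse_def map2_minus_plus list_all2_lengthD algebra_simps
          fps_of_nat[symmetric] fps_const_mult[symmetric] simp del: fps_const_mult)
  qed
  have "fps_nth (msubst n F (\<lambda>i. g i + y i)) M =
      (\<Sum>(e, a)\<in>?S. ?t a (fst e, map2 (-) (snd e) a))"
    unfolding msubst_def fps_nth_Abs_fps
    by (subst sum.Sigma[symmetric])
      (auto simp: finite_mexps_le finite_lists_le mono fps_sum_nth intro!: sum.cong)
  \<comment> \<open>An exponent with a chosen part \<open>a\<close> becomes \<open>a\<close> with
    the remaining exponent; the total degree is preserved, whence the bound in
    \<open>?T\<close>.\<close>
  also have "\<dots> = (\<Sum>(a, e)\<in>?T. ?t a e)"
  proof (rule sum.reindex_bij_witness[where i = ?i and j = ?j])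
    fix p assume "p \<in> ?S"
    then obtain k ks a where p: "p = ((k, ks), a)" "length ks = Suc n" "k + sum_list ks \<le> M"
      "list_all2 (\<le>) a ks"
      by (auto simp: mexps_def mdeg_def)
    have l: "length a = Suc n" using p list_all2_lengthD by fastforce
    have "sum_list (map2 (-) ks a) + sum_list a = sum_list ks"
      using sum_list_map2_plus[of "map2 (-) ks a" a] p l by (simp add: map2_minus_plus)
    then show "?i (?j p) = p" "?j p \<in> ?T"
      using p l by (auto simp: map2_minus_plus mindices_def mexps_def mdeg_def)
    show "(case ?j p of (a, e) \<Rightarrow> ?t a e) = (case p of (e, a) \<Rightarrow> ?t a (fst e, map2 (-) (snd e) a))"
      by (simp add: p)
  next
    fix p assume "p \<in> ?T"
    then obtain k ks a where p: "p = (a, (k, ks))" "length ks = Suc n" "length a = Suc n"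
      "k + sum_list ks + sum_list a \<le> M"
      by (auto simp: mexps_def mdeg_def mindices_def)
    then show "?j (?i p) = p" "?i p \<in> ?S"
      by (auto simp: map2_plus_minus mexps_def mdeg_def sum_list_map2_plus list_all2_le_map2_plus)
  qed
  \<comment> \<open>The added pairs have total degree, hence order, above \<open>M\<close>; they
    contribute zero and make the index set a product.\<close>
  also have "\<dots> = (\<Sum>(a, e)\<in>mindices n M \<times> ?E. ?t a e)"
  proof (rule sum.mono_neutral_left)
    show "\<forall>p\<in>mindices n M \<times> ?E - ?T. (case p of (a, e) \<Rightarrow> ?t a e) = 0"
    proof
      fix p assume "p \<in> mindices n M \<times> ?E - ?T"
      then obtain a e where p: "p = (a, e)" "a \<in> mindices n M" "e \<in> mexps n" "M < mdeg e + sum_list a"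
        by (fastforce intro: not_le_imp_less)
      have "fps_X ^ 1 dvd y i" if "i < length a" for i
        by (rule fps_X_power_dvdI) (use that p y in \<open>auto simp: mindices_def\<close>)
      then have "fps_X ^ (1 * sum_list a) dvd mpow y a"
        by (rule mpow_dvd)
      then have "fps_X ^ (mdeg e + sum_list a) dvd mterm n (hasse a F) g e * mpow y a"
        unfolding power_add using dvd_mterm[OF g p(3)] by (auto intro!: mult_dvd_mono)
      then show "(case p of (a, e) \<Rightarrow> ?t a e) = 0"
        using fps_X_power_dvd_nth p by auto
    qed
  qed (auto simp: finite_mindices finite_mexps_le)
  also have "\<dots> = (\<Sum>a\<in>mindices n M. fps_nth (msubst n (hasse a F) g * mpow y a) M)"
    by (simp add: sum.cartesian_product[symmetric] fps_nth_msubst_mult[OF g])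
  finally show ?thesis .
qed

text \<open>At w = 0 only the monomials free of w survive, and there the binomial factor is 1. So
  every coefficient of \<open>F\<close> can be read off from a divided derivative at 0, in any
  characteristic.\<close>

lemma fps_nth_msubst_hasse_0:
  assumes "length ks = Suc n"
  shows "fps_nth (msubst n (hasse ks F) (\<lambda>_. 0)) k = F (k, ks)"
proof -
  let ?z = "replicate (Suc n) (0::nat)"
  have "mpow (\<lambda>_. 0 :: 'a fps) js = (if set js \<subseteq> {0} then 1 else 0)" for js
    by (induction js) (auto simp: power_0_left)
  moreover have "set js \<subseteq> {0} \<longleftrightarrow> js = ?z" if "length js = Suc n" for js :: "nat list"
    using that by (metis replicate_eqI set_replicate_Suc singletonD subset_eq subset_refl)
  ultimately have z: "mpow (\<lambda>_. 0 :: 'a fps) js = (if js = ?z then 1 else 0)"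
    if "length js = Suc n" for js
    using that by metis
  have "fps_nth (msubst n (hasse ks F) (\<lambda>_. 0)) k = (\<Sum>e\<in>{(k, ?z)}. F (k, ks))"
    unfolding msubst_def fps_nth_Abs_fps
  proof (rule sum.mono_neutral_cong_right)
    have [simp]: "map2 (+) ?z ks = ks" "mbinom ks ks = 1"
      using assms by (auto simp: list_eq_iff_nth_eq mbinom_def simp del: replicate_Suc)
    show "fps_nth (mterm n (hasse ks F) (\<lambda>_. 0) e) k = F (k, ks)" if "e \<in> {(k, ?z)}" for e
      using that by (auto simp: mterm_eq z hasse_def simp del: replicate_Suc)
    show "{(k, ?z)} \<subseteq> {e \<in> mexps n. mdeg e \<le> k}"
      by (auto simp: mexps_def mdeg_def sum_list_replicate)
    show "\<forall>e\<in>{e \<in> mexps n. mdeg e \<le> k} - {(k, ?z)}.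
        fps_nth (mterm n (hasse ks F) (\<lambda>_. 0) e) k = 0"
      by (auto simp: mexps_def mterm_eq z split: if_splits simp del: replicate_Suc)
  qed (rule finite_mexps_le)
  then show ?thesis by simp
qed

text \<open>A nonzero coefficient of \<open>F\<close> makes some \<open>hasse ks F\<close> nonzero
  at 0. Expanding this derivative around \<open>g\<close> with increment \<open>- g\<close> leads
  back to 0, so some term of the expansion is nonzero.\<close>

lemma msubst_hasse_nonzero:
  assumes "\<exists>e\<in>mexps n. F e \<noteq> 0" "\<And>i. i \<le> n \<Longrightarrow> fps_nth (g i) 0 = 0"
  obtains b c where "length b = Suc n" "length c = Suc n" "msubst n (hasse c (hasse b F)) g \<noteq> 0"
proof -
  obtain k ks where ks: "length ks = Suc n" "F (k, ks) \<noteq> 0"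
    using assms(1) by (auto simp: mexps_def)
  have "(\<Sum>a\<in>mindices n k. fps_nth (msubst n (hasse a (hasse ks F)) g * mpow (\<lambda>i. - g i) a) k) \<noteq> 0"
    using msubst_taylor[of n g "\<lambda>i. - g i" "hasse ks F" k] assms(2) ks
    by (simp add: fps_nth_msubst_hasse_0)
  then obtain a where "a \<in> mindices n k" "msubst n (hasse a (hasse ks F)) g \<noteq> 0"
    by (metis (mono_tags, lifting) sum.neutral mult_zero_left fps_zero_nth)
  then show ?thesis using that ks by (auto simp: mindices_def)
qed

section \<open>Ultrametric estimates\<close>

context ultrametric_valued_field
begin

lemma nrm_0 [simp]: "nrm 0 = 0"
  by (simp add: nrm_eq_0_iff)

lemma nrm_1 [simp]: "nrm 1 = 1"
  using nrm_mult[of 1 1] nrm_eq_0_iff[of 1] by simp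

lemma nrm_power: "nrm (x ^ k) = nrm x ^ k"
  by (induction k) (simp_all add: nrm_mult)

lemma nrm_minus [simp]: "nrm (- x) = nrm x"
proof -
  have "nrm (-1) ^ 2 = 1"
    using nrm_power[of "-1" 2] by simp
  then have "nrm (-1) = 1"
    using nrm_nonneg[of "-1"] by (simp add: power2_eq_1_iff)
  then show ?thesis
    using nrm_mult[of "-1" x] by simp
qed

lemma nrm_of_nat_le_1: "nrm (of_nat k) \<le> 1"
proof (induction k)
  case (Suc k)
  then show ?case using nrm_add_le_max[of 1 "of_nat k"] by simp
qed simp

lemma nrm_sum_le:
  assumes "\<And>x. x \<in> S \<Longrightarrow> nrm (f x) \<le> B" "0 \<le> B"
  shows "nrm (sum f S) \<le> B"
  using assms
proof (induction S rule: infinite_finite_induct)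
  case (insert x S)
  then show ?case using nrm_add_le_max[of "f x" "sum f S"] by force
qed simp_all

lemma nrm_sum_attained:
  assumes "sum f S \<noteq> 0"
  obtains x where "x \<in> S" "nrm (sum f S) \<le> nrm (f x)"
proof -
  have S: "finite S" "S \<noteq> {}"
    using assms by (auto intro: ccontr)
  let ?B = "Max ((\<lambda>x. nrm (f x)) ` S)"
  have "?B \<in> (\<lambda>x. nrm (f x)) ` S"
    using S by (intro Max_in) auto
  then obtain x where x: "x \<in> S" "?B = nrm (f x)"
    by auto
  have "nrm (f y) \<le> ?B" if "y \<in> S" for y
    using that S by (intro Max_ge) auto
  then have "nrm (sum f S) \<le> ?B"
    by (rule nrm_sum_le) (simp_all add: x nrm_nonneg)
  then show ?thesis using that x by simp
qed

lemma nrm_add_eq_left: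
  assumes "nrm y < nrm x"
  shows "nrm (x + y) = nrm x"
  using assms nrm_add_le_max[of x y] nrm_add_le_max[of "x + y" "- y"] by auto

text \<open>The consequence of analyticity used below. The condition \<open>1 \<le> C\<close> allows
  \<open>mdeg e\<close> to be replaced by an upper bound such as \<open>M\<close>.\<close>

definition geometric :: "nat \<Rightarrow> (nat \<times> nat list \<Rightarrow> 'a) \<Rightarrow> bool" where
  "geometric n F \<longleftrightarrow> (\<exists>A C. 1 \<le> C \<and> (\<forall>e\<in>mexps n. nrm (F e) \<le> A * C ^ mdeg e))"

lemma geometric_nonneg:
  assumes "geometric n F"
  obtains A C where "0 \<le> A" "1 \<le> C" "\<forall>e\<in>mexps n. nrm (F e) \<le> A * C ^ mdeg e"
proof -
  obtain A C where AC: "1 \<le> C" "\<And>e. e \<in> mexps n \<Longrightarrow> nrm (F e) \<le> A * C ^ mdeg e"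
    using assms by (auto simp: geometric_def)
  have "nrm (F (0, replicate (Suc n) 0)) \<le> A"
    using AC(2)[of "(0, replicate (Suc n) 0)"] by (simp add: mexps_def mdeg_def sum_list_replicate)
  then have "0 \<le> A" using nrm_nonneg order_trans by blast
  then show ?thesis using that AC by blast
qed

text \<open>The limsup controls all large degrees; the finitely many other exponents are absorbed
  into \<open>A\<close>.\<close>

lemma analytic_at_0_imp_geometric:
  assumes "analytic_at_0 nrm n F"
  shows "geometric n F"
proof -
  obtain c :: real where "Limsup (inf (filtercomap mdeg at_top) (principal (mexps n)))
       (\<lambda>e. ereal (root (mdeg e) (nrm (F e)))) < ereal c"
    using assms unfolding analytic_at_0_def by (metis ereal_dense2)
  from Limsup_lessD[OF this] obtain N where
    N: "\<And>e. e \<in> mexps n \<Longrightarrow> N \<le> mdeg e \<Longrightarrow> root (mdeg e) (nrm (F e)) < c"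
    by (auto simp: eventually_inf_principal eventually_filtercomap_at_top_linorder)
  define C where "C = max c 1"
  define S where "S = {e \<in> mexps n. mdeg e \<le> N}"
  define A where "A = 1 + (\<Sum>e\<in>S. nrm (F e))"
  have A: "1 \<le> A" by (simp add: A_def sum_nonneg nrm_nonneg)
  have "nrm (F e) \<le> A * C ^ mdeg e" if e: "e \<in> mexps n" for e
  proof (cases "e \<in> S")
    case True
    then have "nrm (F e) \<le> (\<Sum>e\<in>S. nrm (F e))"
      by (intro member_le_sum) (auto simp: S_def finite_mexps_le nrm_nonneg)
    then have "nrm (F e) \<le> A * 1" by (simp add: A_def)
    also have "\<dots> \<le> A * C ^ mdeg e"
      using A by (intro mult_left_mono) (auto simp: C_def)
    finally show ?thesis .
  next
    case False
    then have d: "N \<le> mdeg e" "0 < mdeg e" using e by (auto simp: S_def)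
    have "nrm (F e) = root (mdeg e) (nrm (F e)) ^ mdeg e"
      using d nrm_nonneg by simp
    also have "\<dots> \<le> C ^ mdeg e"
      using N[OF e d(1)] d nrm_nonneg by (intro power_mono) (auto simp: C_def)
    also have "\<dots> \<le> A * C ^ mdeg e"
      using A by (simp add: C_def)
    finally show ?thesis .
  qed
  then show ?thesis
    unfolding geometric_def by (intro exI[of _ A] exI[of _ C]) (auto simp: C_def)
qed

text \<open>Integers have norm at most 1, so the binomial factors are harmless and only the shift of
  the degree by \<open>sum_list b\<close> costs a constant.\<close>

lemma geometric_hasse:
  assumes "geometric n F" "length b = Suc n"
  shows "geometric n (hasse b F)"
proof -
  obtain A C where AC: "1 \<le> C" "\<And>e. e \<in> mexps n \<Longrightarrow> nrm (F e) \<le> A * C ^ mdeg e"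
    using assms by (auto simp: geometric_def)
  have "nrm (hasse b F e) \<le> A * C ^ sum_list b * C ^ mdeg e" if e': "e \<in> mexps n" for e
  proof -
    obtain k ks where e: "e = (k, ks)" "length ks = Suc n"
      using e' by (auto simp: mexps_def)
    have "nrm (hasse b F e) \<le> nrm (F (k, map2 (+) ks b))"
      by (simp add: hasse_def e nrm_mult mult_left_le_one_le nrm_nonneg nrm_of_nat_le_1)
    also have "\<dots> \<le> A * C ^ mdeg (k, map2 (+) ks b)"
      by (rule AC) (use e assms in \<open>simp add: mexps_def\<close>)
    also have "\<dots> = A * C ^ sum_list b * C ^ mdeg e"
      using e assms by (simp add: mdeg_def sum_list_map2_plus power_add)
    finally show ?thesis .
  qed
  then show ?thesis using AC unfolding geometric_def by blast
qed

section \<open>Coefficients of products and of substituted series\<close>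

(* The list hs collects the exponents that the factors of a product contribute to x^M. *)
definition dominated :: "(nat \<Rightarrow> real) \<Rightarrow> nat \<Rightarrow> 'a fps \<Rightarrow> bool" where
  "dominated w L f \<longleftrightarrow> (\<forall>M. fps_nth f M \<noteq> 0 \<longrightarrow>
     (\<exists>hs. set hs \<subseteq> {1..L} \<and> sum_list hs = M \<and> nrm (fps_nth f M) \<le> prod_list (map w hs)))"

lemma dominated_1: "dominated w L 1"
  by (auto simp: dominated_def intro: exI[of _ "[]"])

text \<open>By the ultrametric inequality a single term of the convolution bounds the coefficient;
  the lists of its two factors are concatenated.\<close>

lemma dominated_mult:
  assumes "dominated w L f" "dominated w L g"
  shows "dominated w L (f * g)"
  unfolding dominated_def
proof (intro allI impI)
  fix M assume nz: "fps_nth (f * g) M \<noteq> 0"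
  obtain i where i: "i \<in> {0..M}"
    "nrm (fps_nth (f * g) M) \<le> nrm (fps_nth f i * fps_nth g (M - i))"
    using nrm_sum_attained[OF nz[unfolded fps_mult_nth]] unfolding fps_mult_nth by blast
  have "0 < nrm (fps_nth (f * g) M)"
    using nz nrm_nonneg[of "fps_nth (f * g) M"] nrm_eq_0_iff[of "fps_nth (f * g) M"] by linarith
  then have "fps_nth f i \<noteq> 0" "fps_nth g (M - i) \<noteq> 0"
    using i by auto
  then obtain hs hs' where h: "set hs \<subseteq> {1..L}" "sum_list hs = i"
    "nrm (fps_nth f i) \<le> prod_list (map w hs)" "set hs' \<subseteq> {1..L}" "sum_list hs' = M - i"
    "nrm (fps_nth g (M - i)) \<le> prod_list (map w hs')"
    using assms unfolding dominated_def by blast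
  have "nrm (fps_nth (f * g) M) \<le> prod_list (map w (hs @ hs'))"
    using i(2) mult_mono[OF h(3,6) order_trans[OF nrm_nonneg h(3)] nrm_nonneg]
    by (simp add: nrm_mult)
  then show "\<exists>hs. set hs \<subseteq> {1..L} \<and> sum_list hs = M \<and>
      nrm (fps_nth (f * g) M) \<le> prod_list (map w hs)"
    using h i by (intro exI[of _ "hs @ hs'"]) auto
qed

lemma dominated_mpow:
  assumes "\<And>i. i < length ks \<Longrightarrow> dominated w L (g i)"
  shows "dominated w L (mpow g ks)"
proof -
  have power: "dominated w L (f ^ k)" if "dominated w L f" for f k
    using that by (induction k) (auto intro: dominated_1 dominated_mult)
  have prod: "dominated w L (prod f S)" if "\<And>i. i \<in> S \<Longrightarrow> dominated w L (f i)" for f and S :: "nat set"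
    using that by (induction S rule: infinite_finite_induct) (auto intro: dominated_1 dominated_mult)
  show ?thesis
    unfolding mpow_def by (intro prod power assms) simp
qed

text \<open>The factor x^k of a monomial leaves only the index \<open>M - k\<close> to the series
  \<open>g i\<close>, which is why \<open>B\<close> has to cover all lists of sum at most
  \<open>M\<close>.\<close>

lemma nrm_msubst_le:
  assumes "0 \<le> A" "1 \<le> C" and F: "\<And>e. e \<in> mexps n \<Longrightarrow> nrm (F e) \<le> A * C ^ mdeg e"
    and g: "\<And>i. i \<le> n \<Longrightarrow> dominated w L (g i)"
    and B: "0 \<le> B" "\<And>hs. set hs \<subseteq> {1..L} \<Longrightarrow> sum_list hs \<le> M \<Longrightarrow> prod_list (map w hs) \<le> B"
  shows "nrm (fps_nth (msubst n F g) M) \<le> A * C ^ M * B"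
  unfolding msubst_def fps_nth_Abs_fps
proof (rule nrm_sum_le)
  fix e assume "e \<in> {e \<in> mexps n. mdeg e \<le> M}"
  then obtain k ks where e: "e = (k, ks)" "length ks = Suc n" "mdeg e \<le> M" "k \<le> M" "e \<in> mexps n"
    by (auto simp: mexps_def mdeg_def)
  have "dominated w L (mpow g ks)"
    by (rule dominated_mpow) (use g e in auto)
  then have "nrm (fps_nth (mpow g ks) (M - k)) \<le> B"
    unfolding dominated_def using B
    by (metis diff_le_self nrm_0 order_trans)
  moreover have "nrm (F e) \<le> A * C ^ M"
    using F[OF e(5)] mult_left_mono[OF power_increasing[OF e(3) assms(2)] assms(1)] by linarith
  moreover have "fps_nth (mterm n F g e) M = F e * fps_nth (mpow g ks) (M - k)"
    using e(2,4) by (simp add: e(1) mterm_eq mult.assoc fps_X_power_mult_nth)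
  ultimately show "nrm (fps_nth (mterm n F g e) M) \<le> A * C ^ M * B"
    using assms(1,2) by (auto simp: nrm_mult intro!: mult_mono nrm_nonneg)
qed (use assms in auto)

text \<open>For large \<open>N\<close> the term with the largest \<open>J\<close> such that
  \<open>c J\<close> is nonzero strictly dominates all others, so it alone determines the norm of
  the sum; \<open>nrm (c J)\<close> serves as \<open>\<delta>\<close>.\<close>

lemma exponential_sum_bounded_below:
  assumes q: "1 < nrm q" and m: "0 < m" and nz: "\<exists>j\<le>n. c j \<noteq> 0"
  obtains \<delta> N\<^sub>0 where "0 < \<delta>" "\<forall>N\<ge>N\<^sub>0. \<delta> \<le> nrm (\<Sum>j\<le>n. c j * ((q ^ j) ^ N) ^ m)"
proof -
  define J where "J = Max {j. j \<le> n \<and> c j \<noteq> 0}"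
  have "J \<in> {j. j \<le> n \<and> c j \<noteq> 0}"
    unfolding J_def using nz by (intro Max_in) auto
  then have J: "J \<le> n" "0 < nrm (c J)"
    using nrm_nonneg nrm_eq_0_iff by (auto simp: order_le_less)
  have J': "c j = 0" if "j \<le> n" "J < j" for j
    using that Max_ge[of "{j. j \<le> n \<and> c j \<noteq> 0}" j] unfolding J_def by fastforce
  \<comment> \<open>From here on, the factor gained by raising \<open>j\<close> by one outweighs
    every ratio of coefficients.\<close>
  obtain N\<^sub>0 where N0: "(\<Sum>j\<le>n. nrm (c j)) / nrm (c J) < nrm q ^ N\<^sub>0"
    using real_arch_pow[OF q] by blast
  have "nrm (c J) \<le> nrm (\<Sum>j\<le>n. c j * ((q ^ j) ^ N) ^ m)" if N: "N\<^sub>0 \<le> N" for N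
  proof -
    let ?t = "\<lambda>j. c j * ((q ^ j) ^ N) ^ m"
    have small: "nrm (?t j) < nrm (?t J)" if j: "j \<in> {..n} - {J}" for j
    proof (cases "J < j")
      case True
      then show ?thesis using J' j J q by (simp add: nrm_mult nrm_power)
    next
      case False
      then have "Suc j \<le> J" using j by auto
      have "nrm (c j) \<le> (\<Sum>j\<le>n. nrm (c j))"
        by (rule member_le_sum) (use j nrm_nonneg in auto)
      also have "\<dots> < nrm q ^ N\<^sub>0 * nrm (c J)"
        using N0 J by (simp add: pos_divide_less_eq)
      also have "\<dots> \<le> nrm q ^ (N * m) * nrm (c J)"
        using N m q J by (intro mult_right_mono power_increasing) (auto intro: order_trans[of _ N])
      finally have "nrm (?t j) < nrm q ^ (N * m) * nrm (c J) * nrm q ^ (j * N * m)"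
        using q by (simp add: nrm_mult nrm_power power_mult)
      also have "\<dots> = nrm (c J) * nrm q ^ (Suc j * (N * m))"
        by (simp add: power_add algebra_simps)
      also have "\<dots> \<le> nrm (c J) * nrm q ^ (J * (N * m))"
        using q J \<open>Suc j \<le> J\<close> by (intro mult_left_mono power_increasing mult_le_mono) auto
      also have "\<dots> = nrm (?t J)"
        by (simp add: nrm_mult nrm_power power_mult)
      finally show ?thesis .
    qed
    have "nrm (sum ?t ({..n} - {J})) < nrm (?t J)"
    proof (cases "sum ?t ({..n} - {J}) = 0")
      case True
      then show ?thesis using J q by (simp add: nrm_mult nrm_power)
    next
      case False
      then obtain j where "j \<in> {..n} - {J}" "nrm (sum ?t ({..n} - {J})) \<le> nrm (?t j)"
        by (rule nrm_sum_attained)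
      then show ?thesis using small[of j] by linarith
    qed
    then have "nrm (\<Sum>j\<le>n. ?t j) = nrm (?t J)"
      using J by (subst sum.remove[of _ J]) (auto simp: nrm_add_eq_left)
    also have "nrm (c J) * 1 \<le> nrm (?t J)"
      unfolding nrm_mult nrm_power using J q
      by (intro mult_left_mono) (auto simp flip: power_mult)
    finally show ?thesis by simp
  qed
  then show ?thesis using that J by blast
qed

end

section \<open>The leading form\<close>

text \<open>The exponent of the pure power \<open>y j ^ m\<close>.\<close>

definition single :: "nat \<Rightarrow> nat \<Rightarrow> nat \<Rightarrow> nat list" where
  "single n m j = (replicate (Suc n) 0)[j := m]"

lemma length_single [simp]: "length (single n m j) = Suc n"
  by (simp add: single_def del: replicate_Suc)

lemma nth_single: "i \<le> n \<Longrightarrow> single n m j ! i = (if i = j then m else 0)"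
  by (auto simp: single_def nth_list_update simp del: replicate_Suc)

lemma sum_list_single: "j \<le> n \<Longrightarrow> sum_list (single n m j) = m"
  by (simp add: single_def sum_list_update sum_list_replicate del: replicate_Suc)

lemma mpow_single: "j \<le> n \<Longrightarrow> mpow y (single n m j) = y j ^ m"
proof -
  assume j: "j \<le> n"
  have "mpow y (single n m j) = (\<Prod>i<Suc n. if i = j then y j ^ m else 1)"
    unfolding mpow_def length_single by (intro prod.cong) (auto simp: nth_single)
  then show ?thesis using j by (simp del: prod.lessThan_Suc)
qed

lemma inj_on_single: "0 < m \<Longrightarrow> inj_on (single n m) {..n}"
  by (intro inj_onI) (metis atMost_iff nth_single less_irrefl)

lemma msubst_cong:
  assumes "\<And>e. e \<in> mexps n \<Longrightarrow> F e = G e"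
  shows "msubst n F g = msubst n G g"
proof -
  have "mterm n F g e = mterm n G g e" if "e \<in> mexps n" for e
    using assms[OF that] by (auto simp: mterm_def split: prod.splits)
  then show ?thesis by (simp add: msubst_def)
qed

lemma hasse_0: "e \<in> mexps n \<Longrightarrow> hasse (replicate (Suc n) 0) F e = F e"
proof -
  assume "e \<in> mexps n"
  then obtain k ks where e: "e = (k, ks)" "length ks = Suc n"
    by (auto simp: mexps_def)
  have "map2 (+) ks (replicate (Suc n) 0) = ks"
    using e by (auto simp: list_eq_iff_nth_eq simp del: replicate_Suc)
  then show ?thesis using e by (simp add: hasse_def mbinom_def del: replicate_Suc)
qed

text \<open>The two derivatives concern disjoint sets of variables, so composing them creates no
  extra binomial factor, which could vanish in positive characteristic.\<close>

lemma hasse_hasse_single: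
  assumes e: "e \<in> mexps n" and b: "length b = Suc n" and j: "j \<le> n"
  shows "hasse (b[j := 0]) (hasse (single n (b ! j) j) F) e = hasse b F e"
proof -
  obtain k ks where e: "e = (k, ks)" "length ks = Suc n"
    using e by (auto simp: mexps_def)
  let ?p = "single n (b ! j) j" and ?b = "b[j := 0]"
  have *: "map2 (+) (map2 (+) ks ?b) ?p = map2 (+) ks b"
    using e b j by (auto simp: list_eq_iff_nth_eq nth_single nth_list_update)
  have "mbinom (map2 (+) ks ?b) ?b * mbinom (map2 (+) ks b) ?p = mbinom (map2 (+) ks b) b"
    unfolding mbinom_def using e b j
    by (auto simp: prod.distrib[symmetric] nth_single nth_list_update simp del: prod.lessThan_Suc
        intro!: prod.cong)
  then show ?thesis
    by (simp add: hasse_def e(1) * mult.assoc[symmetric] flip: of_nat_mult)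
qed

lemma fps_nth_mult_power_lead:
  fixes f y :: "'a::field fps"
  assumes f: "\<And>i. i < v \<Longrightarrow> fps_nth f i = 0" and y: "\<And>i. i < N \<Longrightarrow> fps_nth y i = 0"
  shows "fps_nth (f * y ^ m) (v + N * m) = fps_nth f v * fps_nth y N ^ m"
proof -
  obtain f' where f': "f = fps_X ^ v * f'"
    using fps_X_power_dvdI[OF f] by (auto elim: dvdE)
  obtain y' where y': "y = fps_X ^ N * y'"
    using fps_X_power_dvdI[OF y] by (auto elim: dvdE)
  have "f * y ^ m = fps_X ^ (v + N * m) * (f' * y' ^ m)"
    by (simp add: f' y' power_add power_mult_distrib power_mult algebra_simps)
  then show ?thesis
    by (simp only: fps_X_power_mult_nth) (simp add: f' y' fps_X_power_mult_nth fps_power_zeroth)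
qed

text \<open>Taylor expansion at \<open>g\<close>, where the increment has order at least
  \<open>N\<close> and coefficient \<open>- fps_nth (g j) N\<close> at \<open>N\<close>. Degrees
  below \<open>m\<close> vanish, and in degree \<open>m\<close> only the lowest coefficients of the
  pure powers reach \<open>v + N * m\<close>.\<close>

lemma fps_nth_msubst_cutoff:
  assumes g: "\<And>i. i \<le> n \<Longrightarrow> fps_nth (g i) 0 = 0" and m: "0 < m" and v: "v < N"
    and low: "\<And>b. length b = Suc n \<Longrightarrow> sum_list b < m \<Longrightarrow> msubst n (hasse b F) g = 0"
    and pure: "\<And>b. length b = Suc n \<Longrightarrow> sum_list b = m \<Longrightarrow> msubst n (hasse b F) g \<noteq> 0 \<Longrightarrow>
      \<exists>j\<le>n. b = single n m j"
    and ord: "\<And>j i. j \<le> n \<Longrightarrow> i < v \<Longrightarrow> fps_nth (msubst n (hasse (single n m j) F) g) i = 0"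
  shows "fps_nth (msubst n F (\<lambda>i. fps_cutoff N (g i))) (v + N * m) =
    (\<Sum>j\<le>n. fps_nth (msubst n (hasse (single n m j) F) g) v * (- fps_nth (g j) N) ^ m)"
proof -
  let ?M = "v + N * m"
  let ?y = "\<lambda>i. fps_cutoff N (g i) - g i"
  let ?t = "\<lambda>b. fps_nth (msubst n (hasse b F) g * mpow ?y b) ?M"
  have mM: "m \<le> ?M" using v by (simp add: trans_le_add2)
  have "fps_nth (msubst n F (\<lambda>i. fps_cutoff N (g i))) ?M = (\<Sum>b\<in>mindices n ?M. ?t b)"
    using msubst_taylor[of n g ?y F ?M] g by simp
  also have "\<dots> = (\<Sum>b\<in>single n m ` {..n}. ?t b)"
  proof (rule sum.mono_neutral_right)
    show "single n m ` {..n} \<subseteq> mindices n ?M"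
      using mM by (auto simp: mindices_def sum_list_single)
    show "\<forall>b\<in>mindices n ?M - single n m ` {..n}. ?t b = 0"
    proof
      fix b assume b: "b \<in> mindices n ?M - single n m ` {..n}"
      then have l: "length b = Suc n" by (auto simp: mindices_def)
      consider "sum_list b < m" | "sum_list b = m" | "Suc m \<le> sum_list b"
        by linarith
      then show "?t b = 0"
      proof cases
        case 1
        then show ?thesis using low l by simp
      next
        case 2
        then have "msubst n (hasse b F) g = 0" using pure l b by auto
        then show ?thesis by simp
      next
        case 3
        \<comment> \<open>These terms have order at least \<open>N * (m + 1)\<close>, which exceeds
          \<open>v + N * m\<close> because \<open>v < N\<close>.\<close>
        have "fps_X ^ N dvd ?y i" for i
          by (rule fps_X_power_dvdI) simp
        then have "fps_X ^ (N * sum_list b) dvd msubst n (hasse b F) g * mpow ?y b"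
          by (intro dvd_mult mpow_dvd)
        moreover have "?M < N * sum_list b"
          using mult_le_mono2[OF 3, of N] v by simp
        ultimately show ?thesis by (rule fps_X_power_dvd_nth)
      qed
    qed
  qed (rule finite_mindices)
  also have "\<dots> = (\<Sum>j\<le>n. ?t (single n m j))"
    by (simp add: sum.reindex inj_on_single m)
  also have "\<dots> = (\<Sum>j\<le>n. fps_nth (msubst n (hasse (single n m j) F) g) v * (- fps_nth (g j) N) ^ m)"
    by (intro sum.cong) (auto simp: mpow_single ord fps_nth_mult_power_lead)
  finally show ?thesis .
qed

context ultrametric_valued_field
begin

text \<open>The degree \<open>m\<close> is minimized over all pairs of a series \<open>G\<close>
  vanishing at \<open>g\<close> and a derivative of \<open>G\<close> not vanishing there. The
  competitors include the derivatives of \<open>G\<close>, and this excludes mixed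
  monomials.\<close>

lemma pure_leading_form:
  assumes F: "geometric n F" "msubst n F g = 0" "\<exists>e\<in>mexps n. F e \<noteq> 0"
    and g: "\<And>i. i \<le> n \<Longrightarrow> fps_nth (g i) 0 = 0"
  obtains G m where "geometric n G" "0 < m"
    "\<forall>b. length b = Suc n \<longrightarrow> sum_list b < m \<longrightarrow> msubst n (hasse b G) g = 0"
    "\<forall>b. length b = Suc n \<longrightarrow> sum_list b = m \<longrightarrow> msubst n (hasse b G) g \<noteq> 0 \<longrightarrow>
      (\<exists>j\<le>n. b = single n m j)"
    "\<exists>j\<le>n. msubst n (hasse (single n m j) G) g \<noteq> 0"
proof -
  define P where "P m \<longleftrightarrow> (\<exists>G b. geometric n G \<and> msubst n G g = 0 \<and> length b = Suc n \<and>
    sum_list b = m \<and> msubst n (hasse b G) g \<noteq> 0)" for m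
  have "\<exists>m. P m"
  proof -
    obtain b c where bc: "length b = Suc n" "length c = Suc n"
      "msubst n (hasse c (hasse b F)) g \<noteq> 0"
      using msubst_hasse_nonzero[OF F(3), of g, OF g] by blast
    show ?thesis
    \<comment> \<open>Either \<open>hasse b F\<close> vanishes at \<open>g\<close> and its
      derivative \<open>c\<close> does not, or \<open>F\<close> itself with the derivative
      \<open>b\<close> is a competitor.\<close>
    proof (cases "msubst n (hasse b F) g = 0")
      case True
      then show ?thesis unfolding P_def using bc geometric_hasse[OF F(1)] by blast
    next
      case False
      then show ?thesis unfolding P_def using bc F by blast
    qed
  qed
  define m where "m = (LEAST m. P m)"
  have "P m" unfolding m_def using \<open>\<exists>m. P m\<close> by (rule LeastI_ex)
  have least: "\<not> P k" if "k < m" for k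
    using that not_less_Least unfolding m_def by blast
  obtain G b where G: "geometric n G" "msubst n G g = 0"
    and b: "length b = Suc n" "sum_list b = m" "msubst n (hasse b G) g \<noteq> 0"
    using \<open>P m\<close> unfolding P_def by blast
  \<comment> \<open>The derivative of order 0 is \<open>G\<close> itself, which vanishes at
    \<open>g\<close>.\<close>
  have m: "0 < m"
  proof (rule ccontr)
    assume "\<not> 0 < m"
    then have "b = replicate (Suc n) 0"
      using b by (intro replicate_eqI) auto
    then show False using b G hasse_0 msubst_cong by metis
  qed
  have low: "msubst n (hasse c G) g = 0" if "length c = Suc n" "sum_list c < m" for c
    using least[OF that(2)] that G unfolding P_def by blast
  have pure: "\<exists>j\<le>n. c = single n m j"
    if c: "length c = Suc n" "sum_list c = m" "msubst n (hasse c G) g \<noteq> 0" for c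
  proof -
    have "\<not> (\<forall>x\<in>set c. x = 0)"
      using m c(2) by (metis sum_list_eq_0_iff less_irrefl)
    then obtain j where j: "j \<le> n" "0 < c ! j"
      using c(1) by (metis in_set_conv_nth less_Suc_eq_le neq0_conv)
    have sum: "sum_list (c[j := 0]) + c ! j = m"
      using c j sum_list_update[of j c 0] elem_le_sum_list[of j c] by simp
    show ?thesis
    proof (cases "c ! j = m")
      case True
      then have "sum_list (c[j := 0]) = 0" using sum by simp
      then have z: "c[j := 0] ! i = 0" if "i \<le> n" for i
        using that c(1) by (metis length_list_update nth_mem less_Suc_eq_le sum_list_eq_0_iff)
      have "c = single n m j"
      proof (rule nth_equalityI)
        show "c ! i = single n m j ! i" if "i < length c" for i
          using z[of i] that True c(1) by (auto simp: nth_single nth_list_update split: if_splits)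
      qed (use c in simp)
      then show ?thesis using j by blast
    next
      case False
      \<comment> \<open>\<open>?H\<close> has order \<open>c ! j < m\<close>, so it vanishes at
        \<open>g\<close>. Differentiating it in the other variables gives \<open>hasse c G\<close>,
        which does not vanish: a competitor of degree below \<open>m\<close>.\<close>
      let ?H = "hasse (single n (c ! j) j) G"
      have "msubst n ?H g = 0"
        by (rule low) (use j sum False in \<open>auto simp: sum_list_single\<close>)
      moreover have "msubst n (hasse (c[j := 0]) ?H) g = msubst n (hasse c G) g"
        using hasse_hasse_single c j by (intro msubst_cong) blast
      ultimately have "P (sum_list (c[j := 0]))"
        unfolding P_def using c G geometric_hasse by (metis length_list_update length_single)
      then show ?thesis using least[of "sum_list (c[j := 0])"] sum j by simp
    qed
  qed
  show ?thesis
  proof (rule that[OF G(1) m])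
    show "\<exists>j\<le>n. msubst n (hasse (single n m j) G) g \<noteq> 0"
      using pure[OF b] b by auto
  qed (use low pure in blast)+
qed

end

section \<open>The recursive bound\<close>

(* By convexity the extremal list consists of m entries L and one entry r. *)
lemma sum_squares_le:
  fixes hs :: "nat list"
  assumes hs: "\<And>h. h \<in> set hs \<Longrightarrow> h \<le> L" and sum: "sum_list hs \<le> m * L + r" and r: "r \<le> L"
  shows "(\<Sum>h\<leftarrow>hs. h\<^sup>2) \<le> m * L\<^sup>2 + r\<^sup>2"
proof -
  let ?b = "length (filter (\<lambda>h. r < h) hs)"
  have "(\<Sum>h\<leftarrow>hs. h\<^sup>2) \<le> r * sum_list hs + L * (\<Sum>h\<leftarrow>hs. h - r)"
    using hs
  proof (induction hs)
    case (Cons h hs)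
    have "h\<^sup>2 \<le> r * h + L * (h - r)"
    proof (cases "h \<le> r")
      case False
      then have "h\<^sup>2 = r * h + h * (h - r)"
        by (simp add: power2_eq_square diff_mult_distrib2)
      then show ?thesis using Cons.prems by simp
    qed (simp add: power2_eq_square)
    with Cons show ?case by (simp add: algebra_simps)
  qed simp
  \<comment> \<open>If at most \<open>m\<close> entries exceed \<open>r\<close>, each excess is at
    most \<open>L - r\<close>. Otherwise at least \<open>Suc m\<close> copies of \<open>r\<close>
    can be subtracted from the total \<open>m * L + r\<close>.\<close>
  moreover have "(\<Sum>h\<leftarrow>hs. h - r) \<le> m * (L - r)"
  proof (cases "?b \<le> m")
    case True
    have "(\<Sum>h\<leftarrow>hs. h - r) \<le> ?b * (L - r)"
      using hs
    proof (induction hs)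
      case (Cons h hs)
      then have "(\<Sum>h\<leftarrow>hs. h - r) \<le> length (filter (\<lambda>h. r < h) hs) * (L - r)" "h - r \<le> L - r"
        by (simp_all add: diff_le_mono)
      then show ?case
        by (cases "r < h") (simp_all add: add_mono del: add_diff_assoc add_diff_assoc2 diff_is_0_eq' cong: if_cong)
    qed simp
    then show ?thesis using True by (meson le_trans mult_le_mono1)
  next
    case False
    have "(\<Sum>h\<leftarrow>hs. h - r) + ?b * r \<le> sum_list hs"
      by (induction hs) auto
    moreover have "Suc m * r \<le> ?b * r"
      using False by (intro mult_le_mono1) auto
    ultimately have "(\<Sum>h\<leftarrow>hs. h - r) + m * r \<le> m * L"
      using sum by simp
    then show ?thesis by (simp add: diff_mult_distrib2)
  qed
  ultimately have "(\<Sum>h\<leftarrow>hs. h\<^sup>2) \<le> r * (m * L + r) + L * (m * (L - r))"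
    using sum by (meson add_mono le_trans mult_le_mono2)
  also have "\<dots> = m * (r * L + L * (L - r)) + r\<^sup>2"
    by (simp add: algebra_simps power2_eq_square)
  also have "r * L + L * (L - r) = L\<^sup>2"
    using r by (simp add: diff_mult_distrib2 power2_eq_square mult.commute)
  finally show ?thesis .
qed

context ultrametric_valued_field
begin

text \<open>The quadratic exponent is what makes the induction close: by
  \<open>sum_squares_le\<close>, products of earlier coefficients have exponent about
  \<open>\<sigma> * m * (N - 1)\<^sup>2\<close>, and the gap to
  \<open>\<sigma> * m * N\<^sup>2\<close> grows linearly in \<open>N\<close> and pays for all other
  factors.\<close>

lemma gevrey_bound:
  assumes q: "1 < nrm q" and \<phi>: "fps_nth \<phi> 0 = 0"
    and F: "geometric n F" "msubst n F (\<lambda>i. fps_dilate (q ^ i) \<phi>) = 0" "\<exists>e\<in>mexps n. F e \<noteq> 0"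
  shows "\<exists>\<sigma>. \<forall>h. nrm (fps_nth \<phi> h) \<le> nrm q ^ (\<sigma> * h\<^sup>2)"
proof -
  define Q where "Q = nrm q"
  have Q: "1 < Q" using q by (simp add: Q_def)
  define g where "g = (\<lambda>i. fps_dilate (q ^ i) \<phi>)"
  have g: "fps_nth (g i) h = (q ^ i) ^ h * fps_nth \<phi> h" for i h
    by (simp add: g_def fps_dilate_def)
  have g0: "fps_nth (g i) 0 = 0" for i by (simp add: g \<phi>)
  obtain G m where G: "geometric n G" and m: "0 < m"
    and low: "\<forall>b. length b = Suc n \<longrightarrow> sum_list b < m \<longrightarrow> msubst n (hasse b G) g = 0"
    and pure: "\<forall>b. length b = Suc n \<longrightarrow> sum_list b = m \<longrightarrow> msubst n (hasse b G) g \<noteq> 0 \<longrightarrow>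
      (\<exists>j\<le>n. b = single n m j)"
    and nz: "\<exists>j\<le>n. msubst n (hasse (single n m j) G) g \<noteq> 0"
    by (rule pure_leading_form[OF F(1) F(2)[folded g_def] F(3) g0])
  define d where "d j = msubst n (hasse (single n m j) G) g" for j
  define v where "v = (LEAST v. \<exists>j\<le>n. fps_nth (d j) v \<noteq> 0)"
  have "\<exists>v. \<exists>j\<le>n. fps_nth (d j) v \<noteq> 0"
    using nz unfolding d_def by (metis fps_nonzero_nth)
  then have v: "\<exists>j\<le>n. fps_nth (d j) v \<noteq> 0"
    unfolding v_def by (rule LeastI_ex)
  have ord: "fps_nth (d j) i = 0" if "j \<le> n" "i < v" for j i
    using not_less_Least[OF that(2)[unfolded v_def]] that by blast
  obtain \<delta> N\<^sub>1 where \<delta>: "0 < \<delta>"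
    "\<forall>N\<ge>N\<^sub>1. \<delta> \<le> nrm (\<Sum>j\<le>n. fps_nth (d j) v * ((q ^ j) ^ N) ^ m)"
    by (rule exponential_sum_bounded_below[OF q m v])
  obtain A C where A: "0 \<le> A" and C: "1 \<le> C"
    and GAC: "\<forall>e\<in>mexps n. nrm (G e) \<le> A * C ^ mdeg e"
    by (rule geometric_nonneg[OF G])
  \<comment> \<open>All constants are turned into powers of \<open>Q\<close>, so that only exponents
    remain to be compared.\<close>
  obtain D\<^sub>0 where "max (A / \<delta>) C < Q ^ D\<^sub>0"
    using real_arch_pow[OF Q] by blast
  then have D0: "A \<le> \<delta> * Q ^ D\<^sub>0" "C \<le> Q ^ D\<^sub>0"
    using \<delta>(1) by (auto simp: pos_divide_less_eq mult.commute)
  \<comment> \<open>With \<open>L = N - 1\<close> this makes \<open>v + N * m = m * L + r\<close>,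
    the shape required by \<open>sum_squares_le\<close>.\<close>
  define r where "r = v + m"
  define N\<^sub>0 where "N\<^sub>0 = Suc (N\<^sub>1 + r + m + r\<^sup>2)"
  obtain \<sigma>\<^sub>0 where \<sigma>0: "(\<Sum>h<N\<^sub>0. nrm (fps_nth \<phi> h)) < Q ^ \<sigma>\<^sub>0"
    using real_arch_pow[OF Q] by blast
  \<comment> \<open>\<open>\<sigma>\<^sub>0\<close> covers the indices below
    \<open>N\<^sub>0\<close>; the second summand covers the terms linear in \<open>N\<close> in the
    inductive step.\<close>
  define \<sigma> where "\<sigma> = \<sigma>\<^sub>0 + (D\<^sub>0 + n) * (2 + v)"
  have "nrm (fps_nth \<phi> N) \<le> Q ^ (\<sigma> * N\<^sup>2)" for N
  proof (induction N rule: less_induct)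
    case (less N)
    consider "N = 0" | "0 < N" "N < N\<^sub>0" | "N\<^sub>0 \<le> N" by linarith
    then show ?case
    proof cases
      case 1
      then show ?thesis using \<phi> by simp
    next
      case 2
      have "nrm (fps_nth \<phi> N) \<le> (\<Sum>h<N\<^sub>0. nrm (fps_nth \<phi> h))"
        by (rule member_le_sum) (use 2 nrm_nonneg in auto)
      also have "\<dots> \<le> Q ^ \<sigma>\<^sub>0" using \<sigma>0 by simp
      also have "\<dots> \<le> Q ^ (\<sigma> * N\<^sup>2)"
      proof (rule power_increasing)
        show "\<sigma>\<^sub>0 \<le> \<sigma> * N\<^sup>2"
          using 2 mult_le_mono[of \<sigma>\<^sub>0 \<sigma> 1 "N\<^sup>2"] by (simp add: \<sigma>_def)
      qed (use Q in simp)
      finally show ?thesis .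
    next
      case 3
      define L where "L = N - 1"
      have N: "N = Suc L" "N\<^sub>1 \<le> N" "v < N" "r \<le> L" "m + r\<^sup>2 \<le> N"
        using 3 m by (auto simp: N\<^sub>0_def L_def r_def)
      define M where "M = v + N * m"
      have M: "M = m * L + r" by (simp add: M_def N r_def)
      define E where "E = n * M + \<sigma> * (m * L\<^sup>2 + r\<^sup>2)"
      \<comment> \<open>The part \<open>n * h\<close> accounts for the factors
        \<open>(q ^ i) ^ h\<close> with \<open>i \<le> n\<close>, the part
        \<open>\<sigma> * h\<^sup>2\<close> for the induction hypothesis.\<close>
      let ?w = "\<lambda>h. Q ^ (n * h + \<sigma> * h\<^sup>2)"
      have dom: "dominated ?w L (fps_cutoff N (g i))" if "i \<le> n" for i
        unfolding dominated_def
      proof (intro allI impI)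
        fix h assume "fps_nth (fps_cutoff N (g i)) h \<noteq> 0"
        then have h: "0 < h" "h < N" using g0 by (auto split: if_splits intro: gr0I)
        have "nrm (fps_nth (fps_cutoff N (g i)) h) = Q ^ (i * h) * nrm (fps_nth \<phi> h)"
          using h by (simp add: g nrm_mult nrm_power Q_def power_mult)
        also have "\<dots> \<le> Q ^ (n * h) * Q ^ (\<sigma> * h\<^sup>2)"
          using Q that less h by (intro mult_mono power_increasing) (auto simp: nrm_nonneg)
        finally show "\<exists>hs. set hs \<subseteq> {1..L} \<and> sum_list hs = h \<and>
            nrm (fps_nth (fps_cutoff N (g i)) h) \<le> prod_list (map ?w hs)"
          using h by (intro exI[of _ "[h]"]) (auto simp: L_def power_add)
      qed
      have prod: "prod_list (map ?w hs) \<le> Q ^ E" if "set hs \<subseteq> {1..L}" "sum_list hs \<le> M" for hs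
      proof -
        have "prod_list (map ?w hs) = Q ^ (n * sum_list hs + \<sigma> * (\<Sum>h\<leftarrow>hs. h\<^sup>2))"
          by (induction hs) (simp_all add: algebra_simps flip: power_add)
        also have "\<dots> \<le> Q ^ E"
        proof -
          have "(\<Sum>h\<leftarrow>hs. h\<^sup>2) \<le> m * L\<^sup>2 + r\<^sup>2"
            using that N(4) M by (intro sum_squares_le) auto
          then show ?thesis
            unfolding E_def using Q that by (intro power_increasing add_mono mult_le_mono) auto
        qed
        finally show ?thesis .
      qed
      let ?S = "\<Sum>j\<le>n. fps_nth (d j) v * ((q ^ j) ^ N) ^ m"
      have "fps_nth (msubst n G (\<lambda>i. fps_cutoff N (g i))) M =
          (\<Sum>j\<le>n. fps_nth (d j) v * (- fps_nth (g j) N) ^ m)"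
        unfolding M_def d_def
        by (rule fps_nth_msubst_cutoff[OF g0 m N(3) low[rule_format] pure[rule_format]])
          (use ord in \<open>auto simp: d_def\<close>)
      also have "\<dots> = (- fps_nth \<phi> N) ^ m * ?S"
        unfolding sum_distrib_left
      proof (rule sum.cong)
        fix j
        have "- fps_nth (g j) N = - fps_nth \<phi> N * (q ^ j) ^ N"
          by (simp add: g)
        then show "fps_nth (d j) v * (- fps_nth (g j) N) ^ m =
            (- fps_nth \<phi> N) ^ m * (fps_nth (d j) v * ((q ^ j) ^ N) ^ m)"
          by (simp only: power_mult_distrib mult_ac)
      qed simp
      finally have "fps_nth (msubst n G (\<lambda>i. fps_cutoff N (g i))) M = (- fps_nth \<phi> N) ^ m * ?S" .
      then have "nrm (fps_nth \<phi> N) ^ m * nrm ?S \<le> A * C ^ M * Q ^ E"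
        using nrm_msubst_le[of A C n G ?w L "\<lambda>i. fps_cutoff N (g i)" "Q ^ E" M] A C GAC dom prod Q
        by (simp add: nrm_mult nrm_power)
      moreover have "nrm (fps_nth \<phi> N) ^ m * \<delta> \<le> nrm (fps_nth \<phi> N) ^ m * nrm ?S"
        using \<delta> N by (intro mult_left_mono) (auto simp: nrm_nonneg)
      moreover have "A * C ^ M * Q ^ E \<le> (\<delta> * Q ^ D\<^sub>0) * (Q ^ D\<^sub>0) ^ M * Q ^ E"
        using D0 A C Q \<delta>(1) by (intro mult_mono power_mono) auto
      ultimately have "nrm (fps_nth \<phi> N) ^ m * \<delta> \<le> Q ^ (D\<^sub>0 + D\<^sub>0 * M + E) * \<delta>"
        by (simp add: power_add power_mult mult_ac)
      then have "nrm (fps_nth \<phi> N) ^ m \<le> Q ^ (D\<^sub>0 + D\<^sub>0 * M + E)"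
        using \<delta>(1) by simp
      also have "\<dots> \<le> Q ^ (\<sigma> * N\<^sup>2 * m)"
      proof (rule power_increasing)
        have 1: "1 \<le> N * m" using N m by simp
        have "D\<^sub>0 + D\<^sub>0 * M + n * M \<le> (D\<^sub>0 + n) * (1 + v + N * m)"
          by (simp add: M_def algebra_simps)
        also have "\<dots> \<le> (D\<^sub>0 + n) * ((2 + v) * (N * m))"
          using mult_le_mono2[OF 1, of "1 + v"] by (intro mult_le_mono2) (simp add: algebra_simps)
        also have "\<dots> \<le> \<sigma> * (N * m)"
          unfolding \<sigma>_def mult.assoc[symmetric] by (intro mult_le_mono1) simp
        finally have a: "D\<^sub>0 + D\<^sub>0 * M + n * M \<le> \<sigma> * (N * m)" .
        \<comment> \<open>Passing from \<open>N\<close> to \<open>L\<close> saves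
          \<open>m * (2 * N - 1)\<close>: of this \<open>N * m\<close> absorbs the linear terms, and
          the rest, \<open>m * (N - 1)\<close>, absorbs \<open>r\<^sup>2\<close>.\<close>
        have "\<sigma> * (m * L\<^sup>2 + r\<^sup>2) + \<sigma> * (N * m) \<le> \<sigma> * (N\<^sup>2 * m)"
        proof -
          have "r\<^sup>2 + m \<le> m * N" using N(5) m by (cases m) auto
          then have "m * L\<^sup>2 + r\<^sup>2 + N * m \<le> N\<^sup>2 * m"
            unfolding N(1) by (simp add: power2_eq_square algebra_simps)
          then show ?thesis by (metis add_mult_distrib2 mult_le_mono2)
        qed
        with a show "D\<^sub>0 + D\<^sub>0 * M + E \<le> \<sigma> * N\<^sup>2 * m"
          by (simp add: E_def mult.assoc)
      qed (use Q in simp)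
      finally have "nrm (fps_nth \<phi> N) ^ m \<le> (Q ^ (\<sigma> * N\<^sup>2)) ^ m"
        by (simp add: power_mult)
      then show ?thesis
        using m Q nrm_nonneg by (simp add: power_mono_iff)
    qed
  qed
  then show ?thesis unfolding Q_def by blast
qed

text \<open>With s = 2 \<sigma> the quadratic parts of the exponents cancel and
  \<open>\<sigma> * h\<close> remains, so the h-th roots are bounded by
  \<open>nrm q ^ \<sigma>\<close>.\<close>

lemma q_gevreyI:
  assumes q: "1 < nrm q" and bound: "\<And>h. nrm (fps_nth \<phi> h) \<le> nrm q ^ (\<sigma> * h\<^sup>2)"
  shows "q_gevrey nrm q (2 * real \<sigma>) \<phi>"
proof -
  let ?a = "\<lambda>h. nrm (fps_nth \<phi> h) * nrm q powr (- (2 * real \<sigma>) * (real h * (real h - 1) / 2))"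
  have "root h (?a h) \<le> nrm q ^ \<sigma>" if "1 \<le> h" for h
  proof -
    have "?a h \<le> nrm q powr (\<sigma> * h\<^sup>2) * nrm q powr (- (2 * real \<sigma>) * (real h * (real h - 1) / 2))"
      using bound[of h] q by (intro mult_right_mono) (auto simp flip: powr_realpow)
    also have "\<dots> = nrm q powr (\<sigma> * h)"
      by (simp add: powr_add[symmetric] power2_eq_square field_simps)
    also have "\<dots> = (nrm q ^ \<sigma>) ^ h"
      using q by (simp add: powr_realpow power_mult flip: of_nat_mult)
    finally have "root h (?a h) \<le> root h ((nrm q ^ \<sigma>) ^ h)"
      using that by simp
    then show ?thesis using that q by (simp add: real_root_power_cancel)
  qed
  then have "limsup (\<lambda>h. ereal (root h (?a h))) \<le> ereal (nrm q ^ \<sigma>)"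
    by (intro Limsup_bounded) (auto simp: eventually_sequentially)
  then show ?thesis
    unfolding q_gevrey_def using order_le_less_trans by fastforce
qed

end

theorem corollary5:
  fixes nrm :: "'a::field \<Rightarrow> real"
    and q :: 'a
    and n :: nat
    and F :: "nat \<times> nat list \<Rightarrow> 'a"
    and \<phi> :: "'a fps"
  assumes "complete_ultrametric_valued_field nrm"
    and "nrm q > 1"
    and "F (0, replicate (Suc n) 0) = 0"
    and "analytic_at_0 nrm n F"
    and "fps_nth \<phi> 0 = 0"
    and "msubst n F (\<lambda>i. fps_dilate (q ^ i) \<phi>) = 0"
    and "\<exists>e\<in>mexps n. F e \<noteq> 0"
  shows "\<exists>s::real. q_gevrey nrm q s \<phi>"
proof -
  interpret complete_ultrametric_valued_field nrm by fact
  obtain \<sigma> where "\<forall>h. nrm (fps_nth \<phi> h) \<le> nrm q ^ (\<sigma> * h\<^sup>2)"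
    using gevrey_bound[OF assms(2,5) analytic_at_0_imp_geometric[OF assms(4)] assms(6,7)] by blast
  then show ?thesis using q_gevreyI assms(2) by blast
qed

end
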